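(* Let $\Omega$ be a set, and suppose that $\Omega^\Omega$ is a semitopological semigroup with respect to some $T_1$ topology. If $X\subseteq\Omega^\Omega$ is compact (in this topology), then $X$ is closed and $|(\alpha)X|<\aleph_0$ for all $\alpha\in\Omega$.
   Context: $\Omega^\Omega$ is the monoid of all functions $\Omega\to\Omega$ under composition. Functions are written on the right of their arguments; for $X\subseteq\Omega^\Omega$ and $\alpha\in\Omega$, $(\alpha)X=\{(\alpha)f : f\in X\}$. A semigroup $S$ with a topology is semitopological if for every $s\in S$ the maps $x\mapsto xs$ and $x\mapsto sx$ are continuous maps $S\to S$. Compact means that every open cover has a finite subcover. *)

theory Defs
  imports "HOL-Analysis.T1_Spaces" "HOL-Library.FuncSet"
begin

text \<open>The full transformation monoid on \<open>\<Omega>\<close>: functions on \<open>\<Omega>\<close> are represented by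
  functions that are \<open>undefined\<close> outside \<open>\<Omega>\<close>, so that functions agreeing on \<open>\<Omega>\<close> are equal.\<close>

definition full_transformations :: "'a set \<Rightarrow> ('a \<Rightarrow> 'a) set" where
  "full_transformations \<Omega> = \<Omega> \<rightarrow>\<^sub>E \<Omega>"

text \<open>Functions are written on the right of their arguments: the product of \<open>f\<close> and \<open>g\<close> is
  ``first \<open>f\<close>, then \<open>g\<close>'', hence the swapped arguments of \<^const>\<open>compose\<close>.\<close>

definition transf_mult :: "'a set \<Rightarrow> ('a \<Rightarrow> 'a) \<Rightarrow> ('a \<Rightarrow> 'a) \<Rightarrow> ('a \<Rightarrow> 'a)" where
  "transf_mult \<Omega> f g = compose \<Omega> g f"

text \<open>The semigroup is the underlying set of the topological space, so the operation is only
  constrained there.\<close>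

definition semitopological_semigroup :: "'s topology \<Rightarrow> ('s \<Rightarrow> 's \<Rightarrow> 's) \<Rightarrow> bool" where
  "semitopological_semigroup T m \<longleftrightarrow>
     (\<forall>x\<in>topspace T. \<forall>y\<in>topspace T. m x y \<in> topspace T) \<and>
     (\<forall>x\<in>topspace T. \<forall>y\<in>topspace T. \<forall>z\<in>topspace T. m (m x y) z = m x (m y z)) \<and>
     (\<forall>s\<in>topspace T. continuous_map T T (\<lambda>x. m x s) \<and> continuous_map T T (\<lambda>x. m s x))"

end

theory Submission
  imports Defs
begin

text \<open>Let \<open>c\<^sub>\<gamma>\<close> denote the constant map with value \<open>\<gamma>\<close>. If \<open>\<delta> \<noteq> \<beta>\<close> and \<open>t\<close> fixes \<open>\<beta>\<close> and sends
  every other point to \<open>\<delta>\<close>, then \<open>(\<alpha>)f \<noteq> \<beta>\<close> if and only if \<open>c\<^sub>\<alpha> f t = c\<^sub>\<delta>\<close>. As points are closed and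
  translations are continuous, the maps with \<open>(\<alpha>)f \<noteq> \<beta>\<close> form a closed set. So the topology
  contains the topology of pointwise convergence, which makes it Hausdorff and makes evaluation
  at \<open>\<alpha>\<close> continuous into the discrete space \<open>\<Omega>\<close>.\<close>

lemma openin_point_preimage:
  assumes top: "topspace T = full_transformations \<Omega>"
    and semi: "semitopological_semigroup T (transf_mult \<Omega>)"
    and t1: "t1_space T"
    and \<alpha>: "\<alpha> \<in> \<Omega>" and \<beta>: "\<beta> \<in> \<Omega>"
  shows "openin T {f \<in> topspace T. f \<alpha> = \<beta>}"
proof (cases "\<Omega> = {\<beta>}")
  \<comment> \<open>Over a one-point \<Omega> there is no \<open>\<delta>\<close> to choose, but
    every map sends \<alpha> to \<beta>.\<close>
  case True
  then have "{f \<in> topspace T. f \<alpha> = \<beta>} = topspace T"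
    using \<alpha> by (auto simp: top full_transformations_def)
  then show ?thesis by simp
next
  case False
  then obtain \<delta> where \<delta>: "\<delta> \<in> \<Omega>" "\<delta> \<noteq> \<beta>" using \<beta> by blast
  define c where "c \<gamma> = (\<lambda>x\<in>\<Omega>. \<gamma>)" for \<gamma> :: 'a
  define t where "t = (\<lambda>x\<in>\<Omega>. if x = \<beta> then \<beta> else \<delta>)"
  define \<phi> where "\<phi> = (\<lambda>f. transf_mult \<Omega> (transf_mult \<Omega> (c \<alpha>) f) t)"
  have mem: "c \<alpha> \<in> topspace T" "c \<delta> \<in> topspace T" "t \<in> topspace T"
    using \<alpha> \<beta> \<delta> by (auto simp: top full_transformations_def c_def t_def)
  have "continuous_map T T (\<lambda>f. transf_mult \<Omega> (c \<alpha>) f)"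
    "continuous_map T T (\<lambda>f. transf_mult \<Omega> f t)"
    using semi mem by (auto simp: semitopological_semigroup_def)
  from continuous_map_compose[OF this] have "continuous_map T T \<phi>"
    by (simp add: \<phi>_def comp_def)
  moreover have "closedin T {c \<delta>}"
    using t1 mem by (simp add: t1_space_closedin_singleton)
  ultimately have "closedin T {f \<in> topspace T. \<phi> f \<in> {c \<delta>}}"
    by (rule closedin_continuous_map_preimage)
  moreover have "topspace T - {f \<in> topspace T. \<phi> f \<in> {c \<delta>}} = {f \<in> topspace T. f \<alpha> = \<beta>}"
  proof -
    have "\<phi> f = c \<delta> \<longleftrightarrow> f \<alpha> \<noteq> \<beta>" if "f \<in> topspace T" for f
    proof -
      \<comment> \<open>Since \<open>t\<close> is \<open>undefined\<close> outside \<Omega>,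
        evaluating it at \<open>f \<alpha>\<close> requires this membership.\<close>
      have "f \<alpha> \<in> \<Omega>" using that \<alpha> by (auto simp: top full_transformations_def)
      then have "\<phi> f = c (if f \<alpha> = \<beta> then \<beta> else \<delta>)"
        by (auto simp: \<phi>_def transf_mult_def compose_def c_def t_def fun_eq_iff)
      \<comment> \<open>Constant maps with different values are told apart at a point of \<Omega>,
        and \<alpha> is one.\<close>
      moreover have "c \<beta> \<noteq> c \<delta>"
      proof
        assume "c \<beta> = c \<delta>"
        then have "c \<beta> \<alpha> = c \<delta> \<alpha>" by (rule fun_cong)
        then show False using \<alpha> \<delta> by (simp add: c_def)
      qed
      ultimately show ?thesis by simp
    qed
    then show ?thesis by auto
  qed
  ultimately show ?thesis using openin_diff[OF openin_topspace] by fastforce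
qed

theorem proposition6p2:
  fixes \<Omega> :: "'a set" and T :: "('a \<Rightarrow> 'a) topology" and X :: "('a \<Rightarrow> 'a) set"
  assumes "topspace T = full_transformations \<Omega>"
    and "semitopological_semigroup T (transf_mult \<Omega>)"
    and "t1_space T"
    and "X \<subseteq> full_transformations \<Omega>"
    and "compactin T X"
  shows "closedin T X \<and> (\<forall>\<alpha>\<in>\<Omega>. finite ((\<lambda>f. f \<alpha>) ` X))"
proof
  note op = openin_point_preimage[OF assms(1-3)]
  have ev: "f \<alpha> \<in> \<Omega>" if "f \<in> topspace T" "\<alpha> \<in> \<Omega>" for f \<alpha>
    using that by (auto simp: assms(1) full_transformations_def)
  have "Hausdorff_space T"
    unfolding Hausdorff_space_def
  proof (intro allI impI, elim conjE)
    fix f g assume fg: "f \<in> topspace T" "g \<in> topspace T" "f \<noteq> g"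
    \<comment> \<open>Both maps are \<open>undefined\<close> outside \<Omega>, so they must differ
      inside it; the fibres of evaluation at that point over the two values then separate
      them.\<close>
    then obtain \<alpha> where \<alpha>: "\<alpha> \<in> \<Omega>" "f \<alpha> \<noteq> g \<alpha>"
      unfolding assms(1) full_transformations_def by (metis PiE_ext)
    let ?U = "\<lambda>\<beta>. {h \<in> topspace T. h \<alpha> = \<beta>}"
    have "openin T (?U (f \<alpha>))" "openin T (?U (g \<alpha>))"
      using op ev fg \<alpha> by auto
    moreover have "f \<in> ?U (f \<alpha>)" "g \<in> ?U (g \<alpha>)" "disjnt (?U (f \<alpha>)) (?U (g \<alpha>))"
      using fg \<alpha> by (auto simp: disjnt_def)
    ultimately show "\<exists>U V. openin T U \<and> openin T V \<and> f \<in> U \<and> g \<in> V \<and> disjnt U V"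
      by blast
  qed
  then show "closedin T X"
    using assms(5) by (rule compactin_imp_closedin)
  show "\<forall>\<alpha>\<in>\<Omega>. finite ((\<lambda>f. f \<alpha>) ` X)"
  proof
    fix \<alpha> assume \<alpha>: "\<alpha> \<in> \<Omega>"
    \<comment> \<open>Every subset of the discrete space \<Omega> is open, so continuity of
      evaluation needs open preimages for arbitrary \<open>B\<close>; these are unions of point
      fibres.\<close>
    have "openin T {f \<in> topspace T. f \<alpha> \<in> B}" if "B \<subseteq> \<Omega>" for B
    proof -
      have "{f \<in> topspace T. f \<alpha> \<in> B} = (\<Union>\<beta>\<in>B. {f \<in> topspace T. f \<alpha> = \<beta>})"
        by blast
      moreover have "openin T (\<Union>\<beta>\<in>B. {f \<in> topspace T. f \<alpha> = \<beta>})"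
        using op[OF \<alpha>] that by (intro openin_Union) auto
      ultimately show ?thesis by simp
    qed
    then have "continuous_map T (discrete_topology \<Omega>) (\<lambda>f. f \<alpha>)"
      using ev \<alpha> by (simp add: continuous_map_def)
    \<comment> \<open>The image of \<open>X\<close> is compact in a discrete space, hence
      finite.\<close>
    from image_compactin[OF assms(5) this] show "finite ((\<lambda>f. f \<alpha>) ` X)"
      by (simp add: compactin_discrete_topology)
  qed
qed

end
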